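(* Let $(\mathcal{C},\otimes,\mathbb{1})$ be a right-closed monoidal category and let $(A,m,u)$ be an algebra in $\mathcal{C}$. If $\mathcal{C}$ has equalizers, then the category $\mathsf{Mod}(\mathcal{C})_A$ of right $A$-modules in $\mathcal{C}$ is enriched over $\mathcal{C}$.
   Context: Monoidal categories are taken to be strict (by MacLane's strictness theorem). RIGHT-CLOSED. A monoidal category $(\mathcal{C},\otimes,\mathbb{1})$ is right-closed if for every object $Y$ the functor $-\otimes Y:\mathcal{C}\to\mathcal{C}$ admits a right adjoint $[Y,-]:\mathcal{C}\to\mathcal{C}$. ALGEBRAS AND MODULES. An algebra in $\mathcal{C}$ is a triple $(A,m,u)$ with $A\in\mathcal{C}$ and morphisms $m:A\otimes A\to A$, $u:\mathbb{1}\to A$ in $\mathcal{C}$ satisfying $m(m\otimes\mathrm{id}_A)=m(\mathrm{id}_A\otimes m)$ and $m(u\otimes\mathrm{id}_A)=\mathrm{id}_A=m(\mathrm{id}_A\otimes u)$. A right $A$-module in $\mathcal{C}$ is a pair $(M,\rho)$ with $M\in\mathcal{C}$ and a morphism $\rho:M\otimes A\to M$ in $\mathcal{C}$ satisfying $\rho(\mathrm{id}_M\otimes m)=\rho(\rho\otimes\mathrm{id}_A)$ and $\rho(\mathrm{id}_M\otimes u)=\mathrm{id}_M$. A morphism $(M,\rho^M)\to(N,\rho^N)$ is a morphism $\varphi:M\to N$ in $\mathcal{C}$ with $\rho^N(\varphi\otimes\mathrm{id}_A)=\varphi\,\rho^M$. These form the category $\mathsf{Mod}(\mathcal{C})_A$.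 ENRICHMENT. A category $\mathcal{D}$ enriched over a monoidal category $(\mathcal{V},\otimes^{\mathcal{V}},\mathbb{1}^{\mathcal{V}})$ consists of a class of objects, a Hom-object $\mathcal{D}(X,Y)\in\mathcal{V}$ for each pair of objects, an identity morphism $\mathbb{1}^{\mathcal{V}}\to\mathcal{D}(X,X)$ in $\mathcal{V}$ for each object, and a composition morphism $\mathcal{D}(Y,Z)\otimes^{\mathcal{V}}\mathcal{D}(X,Y)\to\mathcal{D}(X,Z)$ in $\mathcal{V}$ for each triple of objects, satisfying the usual associativity and unitality axioms. *)

theory Defs
  imports Main
begin

section \<open>Categories, functors, adjunctions\<close>

text \<open>Composition is written in the order of functions, and all data are constrained on the
  carriers \<open>Obj\<close> and \<open>Arr\<close> only.\<close>

record ('o, 'a) cat =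
  Obj :: "'o set"
  Arr :: "'a set"
  Dom :: "'a \<Rightarrow> 'o"
  Cod :: "'a \<Rightarrow> 'o"
  Id :: "'o \<Rightarrow> 'a"
  Comp :: "'a \<Rightarrow> 'a \<Rightarrow> 'a" (infixr "\<cdot>\<index>" 55)

definition hom :: "('o, 'a, 'z) cat_scheme \<Rightarrow> 'o \<Rightarrow> 'o \<Rightarrow> 'a set" where
  "hom C X Y = {f \<in> Arr C. Dom C f = X \<and> Cod C f = Y}"

locale category =
  fixes C :: "('o, 'a, 'z) cat_scheme" (structure)
  assumes Dom_closed: "f \<in> Arr C \<Longrightarrow> Dom C f \<in> Obj C"
    and Cod_closed: "f \<in> Arr C \<Longrightarrow> Cod C f \<in> Obj C"
    and Id_hom: "X \<in> Obj C \<Longrightarrow> Id C X \<in> hom C X X"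
    and Comp_hom: "\<lbrakk>f \<in> hom C X Y; g \<in> hom C Y Z\<rbrakk> \<Longrightarrow> g \<cdot> f \<in> hom C X Z"
    and Comp_Id: "f \<in> hom C X Y \<Longrightarrow> f \<cdot> Id C X = f"
    and Id_Comp: "f \<in> hom C X Y \<Longrightarrow> Id C Y \<cdot> f = f"
    and Comp_assoc: "\<lbrakk>f \<in> hom C W X; g \<in> hom C X Y; h \<in> hom C Y Z\<rbrakk>
          \<Longrightarrow> (h \<cdot> g) \<cdot> f = h \<cdot> (g \<cdot> f)"

locale cat_functor = source: category C + target: category D
  for C :: "('o, 'a, 'z) cat_scheme" and D :: "('p, 'b, 'y) cat_scheme" +
  fixes Fo :: "'o \<Rightarrow> 'p" and Fa :: "'a \<Rightarrow> 'b"
  assumes functor_obj: "X \<in> Obj C \<Longrightarrow> Fo X \<in> Obj D"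
    and functor_hom: "f \<in> hom C X Y \<Longrightarrow> Fa f \<in> hom D (Fo X) (Fo Y)"
    and functor_Id: "X \<in> Obj C \<Longrightarrow> Fa (Id C X) = Id D (Fo X)"
    and functor_Comp: "\<lbrakk>f \<in> hom C X Y; g \<in> hom C Y Z\<rbrakk>
          \<Longrightarrow> Fa (g \<cdot>\<^bsub>C\<^esub> f) = Fa g \<cdot>\<^bsub>D\<^esub> Fa f"

definition cat_isomorphism ::
  "('o, 'a, 'z) cat_scheme \<Rightarrow> ('p, 'b, 'y) cat_scheme \<Rightarrow> ('o \<Rightarrow> 'p) \<Rightarrow> ('a \<Rightarrow> 'b) \<Rightarrow> bool" where
  "cat_isomorphism C D Fo Fa \<longleftrightarrow>
     cat_functor C D Fo Fa \<and> bij_betw Fo (Obj C) (Obj D) \<and> bij_betw Fa (Arr C) (Arr D)"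

text \<open>\<open>G\<close> is right adjoint to \<open>F\<close>: bijections \<open>hom D (F X) Y \<cong> hom C X (G Y)\<close>, natural in
  \<open>X\<close> and \<open>Y\<close> (both naturality squares are expressed by a single equation).\<close>

definition right_adjoint ::
  "('o, 'a, 'z) cat_scheme \<Rightarrow> ('p, 'b, 'y) cat_scheme \<Rightarrow>
   ('o \<Rightarrow> 'p) \<Rightarrow> ('a \<Rightarrow> 'b) \<Rightarrow> ('p \<Rightarrow> 'o) \<Rightarrow> ('b \<Rightarrow> 'a) \<Rightarrow> bool" where
  "right_adjoint C D Fo Fa Go Ga \<longleftrightarrow>
     cat_functor C D Fo Fa \<and> cat_functor D C Go Ga \<and>
     (\<exists>\<phi>. (\<forall>X\<in>Obj C. \<forall>Y\<in>Obj D. bij_betw (\<phi> X Y) (hom D (Fo X) Y) (hom C X (Go Y))) \<and>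
          (\<forall>X\<in>Obj C. \<forall>X'\<in>Obj C. \<forall>Y\<in>Obj D. \<forall>Y'\<in>Obj D.
             \<forall>f\<in>hom C X' X. \<forall>h\<in>hom D (Fo X) Y. \<forall>k\<in>hom D Y Y'.
               \<phi> X' Y' (k \<cdot>\<^bsub>D\<^esub> h \<cdot>\<^bsub>D\<^esub> Fa f) = Ga k \<cdot>\<^bsub>C\<^esub> \<phi> X Y h \<cdot>\<^bsub>C\<^esub> f))"

definition is_equalizer :: "('o, 'a, 'z) cat_scheme \<Rightarrow> 'a \<Rightarrow> 'a \<Rightarrow> 'o \<Rightarrow> 'o \<Rightarrow> 'o \<Rightarrow> 'a \<Rightarrow> bool" where
  "is_equalizer C f g X Y E e \<longleftrightarrow>
     E \<in> Obj C \<and> e \<in> hom C E X \<and> f \<cdot>\<^bsub>C\<^esub> e = g \<cdot>\<^bsub>C\<^esub> e \<and>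
     (\<forall>Z\<in>Obj C. \<forall>h\<in>hom C Z X. f \<cdot>\<^bsub>C\<^esub> h = g \<cdot>\<^bsub>C\<^esub> h \<longrightarrow> (\<exists>!k. k \<in> hom C Z E \<and> e \<cdot>\<^bsub>C\<^esub> k = h))"

definition has_equalizers :: "('o, 'a, 'z) cat_scheme \<Rightarrow> bool" where
  "has_equalizers C \<longleftrightarrow>
     (\<forall>X\<in>Obj C. \<forall>Y\<in>Obj C. \<forall>f\<in>hom C X Y. \<forall>g\<in>hom C X Y. \<exists>E e. is_equalizer C f g X Y E e)"


section \<open>Strict monoidal categories\<close>

record ('o, 'a) moncat = "('o, 'a) cat" +
  TensorObj :: "'o \<Rightarrow> 'o \<Rightarrow> 'o" (infixr "\<odot>\<index>" 70)
  TensorArr :: "'a \<Rightarrow> 'a \<Rightarrow> 'a" (infixr "\<otimes>\<index>" 70)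
  Unit :: "'o" ("\<one>\<index>")

locale monoidal_category = category C
  for C :: "('o, 'a, 'z) moncat_scheme" (structure) +
  assumes tensor_obj: "\<lbrakk>X \<in> Obj C; Y \<in> Obj C\<rbrakk> \<Longrightarrow> X \<odot> Y \<in> Obj C"
    and unit_obj: "\<one> \<in> Obj C"
    and tensor_hom: "\<lbrakk>f \<in> hom C X X'; g \<in> hom C Y Y'\<rbrakk> \<Longrightarrow> f \<otimes> g \<in> hom C (X \<odot> Y) (X' \<odot> Y')"
    and tensor_Id: "\<lbrakk>X \<in> Obj C; Y \<in> Obj C\<rbrakk> \<Longrightarrow> Id C X \<otimes> Id C Y = Id C (X \<odot> Y)"
    and interchange: "\<lbrakk>f \<in> hom C X X'; f' \<in> hom C X' X''; g \<in> hom C Y Y'; g' \<in> hom C Y' Y''\<rbrakk>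
          \<Longrightarrow> (f' \<cdot> f) \<otimes> (g' \<cdot> g) = (f' \<otimes> g') \<cdot> (f \<otimes> g)"
    and tensor_obj_assoc: "\<lbrakk>X \<in> Obj C; Y \<in> Obj C; Z \<in> Obj C\<rbrakk>
          \<Longrightarrow> (X \<odot> Y) \<odot> Z = X \<odot> (Y \<odot> Z)"
    and tensor_arr_assoc: "\<lbrakk>f \<in> Arr C; g \<in> Arr C; h \<in> Arr C\<rbrakk>
          \<Longrightarrow> (f \<otimes> g) \<otimes> h = f \<otimes> (g \<otimes> h)"
    and unit_tensor_obj: "X \<in> Obj C \<Longrightarrow> \<one> \<odot> X = X"
    and tensor_unit_obj: "X \<in> Obj C \<Longrightarrow> X \<odot> \<one> = X"
    and unit_tensor_arr: "f \<in> Arr C \<Longrightarrow> Id C \<one> \<otimes> f = f"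
    and tensor_unit_arr: "f \<in> Arr C \<Longrightarrow> f \<otimes> Id C \<one> = f"

locale right_closed_monoidal_category = monoidal_category C
  for C :: "('o, 'a, 'z) moncat_scheme" (structure) +
  assumes right_closed: "Y \<in> Obj C \<Longrightarrow>
    \<exists>Go Ga. right_adjoint C C (\<lambda>X. X \<odot> Y) (\<lambda>f. f \<otimes> Id C Y) Go Ga"


section \<open>Algebras and right modules\<close>

locale algebra_in = monoidal_category C
  for C :: "('o, 'a, 'z) moncat_scheme" (structure) +
  fixes A :: 'o and m u :: 'a
  assumes A_obj: "A \<in> Obj C"
    and m_hom: "m \<in> hom C (A \<odot> A) A"
    and u_hom: "u \<in> hom C \<one> A"
    and m_assoc: "m \<cdot> (m \<otimes> Id C A) = m \<cdot> (Id C A \<otimes> m)"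
    and left_unit: "m \<cdot> (u \<otimes> Id C A) = Id C A"
    and right_unit: "m \<cdot> (Id C A \<otimes> u) = Id C A"

definition right_module ::
  "('o, 'a, 'z) moncat_scheme \<Rightarrow> 'o \<Rightarrow> 'a \<Rightarrow> 'a \<Rightarrow> 'o \<Rightarrow> 'a \<Rightarrow> bool" where
  "right_module C A m u M \<rho> \<longleftrightarrow>
     M \<in> Obj C \<and> \<rho> \<in> hom C (M \<odot>\<^bsub>C\<^esub> A) M \<and>
     \<rho> \<cdot>\<^bsub>C\<^esub> (Id C M \<otimes>\<^bsub>C\<^esub> m) = \<rho> \<cdot>\<^bsub>C\<^esub> (\<rho> \<otimes>\<^bsub>C\<^esub> Id C A) \<and>
     \<rho> \<cdot>\<^bsub>C\<^esub> (Id C M \<otimes>\<^bsub>C\<^esub> u) = Id C M"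

definition module_hom ::
  "('o, 'a, 'z) moncat_scheme \<Rightarrow> 'o \<Rightarrow> 'o \<times> 'a \<Rightarrow> 'o \<times> 'a \<Rightarrow> 'a set" where
  "module_hom C A M N =
     {\<phi> \<in> hom C (fst M) (fst N). snd N \<cdot>\<^bsub>C\<^esub> (\<phi> \<otimes>\<^bsub>C\<^esub> Id C A) = \<phi> \<cdot>\<^bsub>C\<^esub> snd M}"

text \<open>The same arrow of \<open>C\<close> may be a morphism between several pairs of modules, so arrows
  of the category of modules carry their source and target.\<close>

definition module_category ::
  "('o, 'a, 'z) moncat_scheme \<Rightarrow> 'o \<Rightarrow> 'a \<Rightarrow> 'a \<Rightarrow>
   ('o \<times> 'a, ('o \<times> 'a) \<times> 'a \<times> ('o \<times> 'a)) cat" where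
  "module_category C A m u =
     (let Mods = {(M, \<rho>). right_module C A m u M \<rho>} in
      \<lparr> Obj = Mods,
        Arr = {(M, \<phi>, N). M \<in> Mods \<and> N \<in> Mods \<and> \<phi> \<in> module_hom C A M N},
        Dom = (\<lambda>(M, \<phi>, N). M),
        Cod = (\<lambda>(M, \<phi>, N). N),
        Id = (\<lambda>M. (M, Id C (fst M), M)),
        Comp = (\<lambda>(_, \<psi>, P) (M, \<phi>, _). (M, \<psi> \<cdot>\<^bsub>C\<^esub> \<phi>, P)) \<rparr>)"


section \<open>Enriched categories\<close>

record ('x, 'o, 'a) encat =
  EObj :: "'x set"
  EHom :: "'x \<Rightarrow> 'x \<Rightarrow> 'o"
  EId :: "'x \<Rightarrow> 'a"
  EComp :: "'x \<Rightarrow> 'x \<Rightarrow> 'x \<Rightarrow> 'a"  \<comment> \<open>\<open>EComp X Y Z : EHom Y Z \<odot> EHom X Y \<rightarrow> EHom X Z\<close>\<close>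

locale enriched_category = monoidal_category V
  for V :: "('o, 'a, 'z) moncat_scheme" (structure) +
  fixes E :: "('x, 'o, 'a) encat"
  assumes EHom_obj: "\<lbrakk>X \<in> EObj E; Y \<in> EObj E\<rbrakk> \<Longrightarrow> EHom E X Y \<in> Obj V"
    and EId_hom: "X \<in> EObj E \<Longrightarrow> EId E X \<in> hom V \<one> (EHom E X X)"
    and EComp_hom: "\<lbrakk>X \<in> EObj E; Y \<in> EObj E; Z \<in> EObj E\<rbrakk>
          \<Longrightarrow> EComp E X Y Z \<in> hom V (EHom E Y Z \<odot> EHom E X Y) (EHom E X Z)"
    and EComp_assoc: "\<lbrakk>W \<in> EObj E; X \<in> EObj E; Y \<in> EObj E; Z \<in> EObj E\<rbrakk>
          \<Longrightarrow> EComp E W X Z \<cdot> (EComp E X Y Z \<otimes> Id V (EHom E W X))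
            = EComp E W Y Z \<cdot> (Id V (EHom E Y Z) \<otimes> EComp E W X Y)"
    and EComp_EId: "\<lbrakk>X \<in> EObj E; Y \<in> EObj E\<rbrakk>
          \<Longrightarrow> EComp E X X Y \<cdot> (Id V (EHom E X Y) \<otimes> EId E X) = Id V (EHom E X Y)"
    and EId_EComp: "\<lbrakk>X \<in> EObj E; Y \<in> EObj E\<rbrakk>
          \<Longrightarrow> EComp E X Y Y \<cdot> (EId E Y \<otimes> Id V (EHom E X Y)) = Id V (EHom E X Y)"

text \<open>The underlying ordinary category: arrows \<open>X \<rightarrow> Y\<close> are the arrows \<open>\<one> \<rightarrow> EHom X Y\<close> of \<open>V\<close>.
  In the composite, strictness gives \<open>g \<otimes> f : \<one> = \<one> \<odot> \<one> \<rightarrow> EHom Y Z \<odot> EHom X Y\<close>.\<close>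

definition underlying_category ::
  "('o, 'a, 'z) moncat_scheme \<Rightarrow> ('x, 'o, 'a) encat \<Rightarrow> ('x, 'x \<times> 'a \<times> 'x) cat" where
  "underlying_category V E =
     \<lparr> Obj = EObj E,
       Arr = {(X, f, Y). X \<in> EObj E \<and> Y \<in> EObj E \<and> f \<in> hom V \<one>\<^bsub>V\<^esub> (EHom E X Y)},
       Dom = (\<lambda>(X, f, Y). X),
       Cod = (\<lambda>(X, f, Y). Y),
       Id = (\<lambda>X. (X, EId E X, X)),
       Comp = (\<lambda>(Y, g, Z) (X, f, _). (X, EComp E X Y Z \<cdot>\<^bsub>V\<^esub> (g \<otimes>\<^bsub>V\<^esub> f), Z)) \<rparr>"

text \<open>An ordinary category \<open>D\<close> is enriched over \<open>V\<close> if it is, up to an isomorphism that is the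
  identity on objects, the underlying category of a \<open>V\<close>-enriched category.  Without the link to
  the arrows of \<open>D\<close> the notion would be void: the constant family \<open>EHom X Y = \<one>\<close> is always an
  enriched category.\<close>

definition enriched_over ::
  "('x, 'b, 'y) cat_scheme \<Rightarrow> ('o, 'a, 'z) moncat_scheme \<Rightarrow> bool" where
  "enriched_over D V \<longleftrightarrow>
     (\<exists>E :: ('x, 'o, 'a) encat. enriched_category V E \<and> EObj E = Obj D \<and>
        (\<exists>Fa. cat_isomorphism (underlying_category V E) D (\<lambda>X. X) Fa))"

end

theory Submission
  imports Defs
begin

text \<open>For right modules \<open>M\<close>, \<open>N\<close> and an object \<open>Z\<close> call \<open>h : Z \<odot> M \<rightarrow> N\<close> linear if it commutes with
  the actions of \<open>A\<close>, the algebra acting on \<open>Z \<odot> M\<close> through \<open>M\<close>.  The functor sending \<open>Z\<close> to the set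
  of linear maps \<open>Z \<odot> M \<rightarrow> N\<close> is represented by the equalizer of the two maps \<open>[M, N] \<rightarrow> [M \<odot> A, N]\<close>
  that are adjoint to \<open>\<rho>\<^sub>N \<cdot> (ev \<otimes> A)\<close> and \<open>ev \<cdot> ([M, N] \<otimes> \<rho>\<^sub>M)\<close>.  The representing object is the
  Hom-object; composition and identities are induced by the universal property, which also yields
  the enriched axioms, and taking \<open>Z = \<one>\<close> recovers the module maps.\<close>

section \<open>Arrows of a strict monoidal category\<close>

context category
begin

lemma homD: "f \<in> hom C X Y \<Longrightarrow> f \<in> Arr C" "f \<in> hom C X Y \<Longrightarrow> Dom C f = X"
  "f \<in> hom C X Y \<Longrightarrow> Cod C f = Y"
  by (auto simp: hom_def)

lemma hom_obj: "f \<in> hom C X Y \<Longrightarrow> X \<in> Obj C" "f \<in> hom C X Y \<Longrightarrow> Y \<in> Obj C"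
  using Dom_closed Cod_closed by (auto simp: hom_def)

text \<open>Axioms such as \<open>Comp_hom\<close> have a middle object that occurs only in the
  premises. Typing by \<open>Arr\<close>, \<open>Dom\<close> and \<open>Cod\<close> gives
  conditional rewrite rules whose side conditions can be computed.\<close>

lemma comp_arr:
  assumes "f \<in> Arr C" "g \<in> Arr C" "Dom C g = Cod C f"
  shows "g \<cdot> f \<in> Arr C" "Dom C (g \<cdot> f) = Dom C f" "Cod C (g \<cdot> f) = Cod C g"
  using Comp_hom[of f "Dom C f" "Cod C f" g "Cod C g"] assms by (auto simp: hom_def)

lemma id_arr:
  assumes "X \<in> Obj C"
  shows "Id C X \<in> Arr C" "Dom C (Id C X) = X" "Cod C (Id C X) = X"
  using Id_hom[OF assms] by (auto simp: hom_def)

lemma comp_assoc_arr: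
  assumes "f \<in> Arr C" "g \<in> Arr C" "h \<in> Arr C" "Dom C g = Cod C f" "Dom C h = Cod C g"
  shows "(h \<cdot> g) \<cdot> f = h \<cdot> (g \<cdot> f)"
  using Comp_assoc[of f "Dom C f" "Cod C f" g "Cod C g" h "Cod C h"] assms by (auto simp: hom_def)

lemma comp_id_arr:
  assumes "f \<in> Arr C"
  shows "Dom C f = X \<Longrightarrow> f \<cdot> Id C X = f" "Cod C f = Y \<Longrightarrow> Id C Y \<cdot> f = f"
  using Comp_Id[of f] Id_Comp[of f] assms by (auto simp: hom_def)

end

context monoidal_category
begin

lemma tensor_arr:
  assumes "f \<in> Arr C" "g \<in> Arr C"
  shows "f \<otimes> g \<in> Arr C" "Dom C (f \<otimes> g) = Dom C f \<odot> Dom C g" "Cod C (f \<otimes> g) = Cod C f \<odot> Cod C g"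
  using tensor_hom[of f "Dom C f" "Cod C f" g "Dom C g" "Cod C g"] assms by (auto simp: hom_def)

text \<open>Oriented against \<open>interchange\<close>, so that rewriting merges a composite of
  tensors into one tensor.\<close>

lemma interchange_arr:
  assumes "f \<in> Arr C" "f' \<in> Arr C" "g \<in> Arr C" "g' \<in> Arr C" "Dom C f' = Cod C f" "Dom C g' = Cod C g"
  shows "(f' \<otimes> g') \<cdot> (f \<otimes> g) = (f' \<cdot> f) \<otimes> (g' \<cdot> g)"
  using interchange[of f "Dom C f" "Cod C f" f' "Cod C f'" g "Dom C g" "Cod C g" g' "Cod C g'"] assms
  by (auto simp: hom_def)

text \<open>Computes types, removes identities and unit factors, and brackets tensors to the right.
  \<open>comp_assoc_arr\<close> and \<open>interchange_arr\<close> stay out and are invoked step by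
  step.\<close>

lemmas arr_simps = Dom_closed Cod_closed comp_arr id_arr comp_id_arr tensor_arr tensor_obj unit_obj
  tensor_obj_assoc tensor_arr_assoc unit_tensor_obj tensor_unit_obj unit_tensor_arr tensor_unit_arr
  tensor_Id

end


section \<open>The underlying category\<close>

context enriched_category
begin

lemma hom_underlying_category:
  "hom (underlying_category V E) X Y
    = (if X \<in> EObj E \<and> Y \<in> EObj E then (\<lambda>f. (X, f, Y)) ` hom V \<one> (EHom E X Y) else {})"
  by (auto simp: hom_def underlying_category_def)

lemma tensor_unit_hom:
  assumes "f \<in> hom V \<one> X" "g \<in> hom V \<one> Y"
  shows "g \<otimes> f \<in> hom V \<one> (Y \<odot> X)"
  using tensor_hom[OF assms(2,1)] by (simp add: unit_tensor_obj unit_obj)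

text \<open>The enriched laws, evaluated on arrows out of the unit, become the ordinary category
  laws.\<close>

lemma category_underlying_category: "category (underlying_category V E)"
proof
  show "g \<cdot>\<^bsub>underlying_category V E\<^esub> f \<in> hom (underlying_category V E) X Z"
    if "f \<in> hom (underlying_category V E) X Y" "g \<in> hom (underlying_category V E) Y Z" for f X Y g Z
    using that Comp_hom[OF tensor_unit_hom EComp_hom]
    unfolding hom_underlying_category
    by (auto simp: underlying_category_def split: if_splits)
next
  fix X Y and a assume "a \<in> hom (underlying_category V E) X Y"
  then obtain f where f: "a = (X, f, Y)" "f \<in> hom V \<one> (EHom E X Y)"
    and XY: "X \<in> EObj E" "Y \<in> EObj E"
    unfolding hom_underlying_category by (auto split: if_splits)
  note [simp] = arr_simps homD[OF f(2)] EHom_obj XY homD[OF EId_hom] homD[OF EComp_hom]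
  \<comment> \<open>The unit law is precomposed with \<open>f\<close>, which by strictness is also
    \<open>f \<otimes> Id V \<one>\<close>; interchange then absorbs the identity of the
    Hom-object.\<close>
  have "f = (EComp E X X Y \<cdot> (Id V (EHom E X Y) \<otimes> EId E X)) \<cdot> (f \<otimes> Id V \<one>)"
    by (simp add: EComp_EId)
  also have "\<dots> = EComp E X X Y \<cdot> ((Id V (EHom E X Y) \<otimes> EId E X) \<cdot> (f \<otimes> Id V \<one>))"
    by (rule comp_assoc_arr) simp_all
  also have "\<dots> = EComp E X X Y \<cdot> (f \<otimes> EId E X)"
    by (subst interchange_arr) simp_all
  finally show "a \<cdot>\<^bsub>underlying_category V E\<^esub> Id (underlying_category V E) X = a"
    by (simp add: f(1) underlying_category_def)
  have "f = (EComp E X Y Y \<cdot> (EId E Y \<otimes> Id V (EHom E X Y))) \<cdot> (Id V \<one> \<otimes> f)"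
    by (simp add: EId_EComp)
  also have "\<dots> = EComp E X Y Y \<cdot> ((EId E Y \<otimes> Id V (EHom E X Y)) \<cdot> (Id V \<one> \<otimes> f))"
    by (rule comp_assoc_arr) simp_all
  also have "\<dots> = EComp E X Y Y \<cdot> (EId E Y \<otimes> f)"
    by (subst interchange_arr) simp_all
  finally show "Id (underlying_category V E) Y \<cdot>\<^bsub>underlying_category V E\<^esub> a = a"
    by (simp add: f(1) underlying_category_def)
next
  fix W X Y Z and a b c assume "a \<in> hom (underlying_category V E) W X"
    "b \<in> hom (underlying_category V E) X Y" "c \<in> hom (underlying_category V E) Y Z"
  then obtain f g h where f: "a = (W, f, X)" "f \<in> hom V \<one> (EHom E W X)"
    and g: "b = (X, g, Y)" "g \<in> hom V \<one> (EHom E X Y)"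
    and h: "c = (Y, h, Z)" "h \<in> hom V \<one> (EHom E Y Z)"
    and O: "W \<in> EObj E" "X \<in> EObj E" "Y \<in> EObj E" "Z \<in> EObj E"
    unfolding hom_underlying_category by (auto split: if_splits)
  note [simp] = arr_simps homD[OF f(2)] homD[OF g(2)] homD[OF h(2)] EHom_obj O homD[OF EComp_hom]
  \<comment> \<open>Both bracketings pass through the triple tensor
    \<open>h \<otimes> (g \<otimes> f)\<close>, where enriched associativity applies.\<close>
  have "EComp E W X Z \<cdot> ((EComp E X Y Z \<cdot> (h \<otimes> g)) \<otimes> f)
      = EComp E W X Z \<cdot> ((EComp E X Y Z \<otimes> Id V (EHom E W X)) \<cdot> ((h \<otimes> g) \<otimes> f))"
    by (subst interchange_arr) simp_all
  also have "\<dots> = (EComp E W X Z \<cdot> (EComp E X Y Z \<otimes> Id V (EHom E W X))) \<cdot> (h \<otimes> (g \<otimes> f))"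
    by (simp add: comp_assoc_arr)
  also have "\<dots> = EComp E W Y Z \<cdot> ((Id V (EHom E Y Z) \<otimes> EComp E W X Y) \<cdot> (h \<otimes> (g \<otimes> f)))"
    unfolding EComp_assoc[OF O] by (simp add: comp_assoc_arr)
  also have "\<dots> = EComp E W Y Z \<cdot> (h \<otimes> (EComp E W X Y \<cdot> (g \<otimes> f)))"
    by (subst interchange_arr) simp_all
  finally show "(c \<cdot>\<^bsub>underlying_category V E\<^esub> b) \<cdot>\<^bsub>underlying_category V E\<^esub> a
      = c \<cdot>\<^bsub>underlying_category V E\<^esub> (b \<cdot>\<^bsub>underlying_category V E\<^esub> a)"
    by (simp add: f(1) g(1) h(1) underlying_category_def)
qed (auto simp: hom_def underlying_category_def EId_hom[unfolded hom_def, simplified])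

end

section \<open>Internal Homs by universal property\<close>

context right_closed_monoidal_category
begin

text \<open>The adjunction is traded for its counit at \<open>N\<close>, viewed as a universal
  arrow.\<close>

lemma internal_hom_exists:
  assumes Y: "Y \<in> Obj C" and N: "N \<in> Obj C"
  obtains H ev where "H \<in> Obj C" "ev \<in> hom C (H \<odot> Y) N"
    "\<And>Z h. \<lbrakk>Z \<in> Obj C; h \<in> hom C (Z \<odot> Y) N\<rbrakk> \<Longrightarrow> \<exists>!k. k \<in> hom C Z H \<and> ev \<cdot> (k \<otimes> Id C Y) = h"
proof -
  obtain Go Ga where adj: "right_adjoint C C (\<lambda>X. X \<odot> Y) (\<lambda>f. f \<otimes> Id C Y) Go Ga"
    using right_closed[OF Y] by blast
  then interpret G: cat_functor C C Go Ga by (simp add: right_adjoint_def)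
  obtain \<phi> where
    bij: "\<And>X Z. \<lbrakk>X \<in> Obj C; Z \<in> Obj C\<rbrakk> \<Longrightarrow> bij_betw (\<phi> X Z) (hom C (X \<odot> Y) Z) (hom C X (Go Z))"
    and nat: "\<And>X X' Z Z' f h k. \<lbrakk>X \<in> Obj C; X' \<in> Obj C; Z \<in> Obj C; Z' \<in> Obj C; f \<in> hom C X' X;
      h \<in> hom C (X \<odot> Y) Z; k \<in> hom C Z Z'\<rbrakk>
      \<Longrightarrow> \<phi> X' Z' (k \<cdot> h \<cdot> (f \<otimes> Id C Y)) = Ga k \<cdot> \<phi> X Z h \<cdot> f"
    using adj unfolding right_adjoint_def by blast
  have H: "Go N \<in> Obj C" using G.functor_obj N by blast
  \<comment> \<open>\<open>ev\<close> is the counit: the arrow that \<phi> sends to the identity of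
    \<open>Go N\<close>.\<close>
  obtain ev where ev: "ev \<in> hom C (Go N \<odot> Y) N" and \<phi>_ev: "\<phi> (Go N) N ev = Id C (Go N)"
    using bij_betw_imp_surj_on[OF bij[OF H N]] Id_hom[OF H] by (metis imageE)
  \<comment> \<open>Naturality along \<open>k\<close>, applied to \<open>ev\<close>, makes \<phi> a
    left inverse of \<open>k \<mapsto> ev \<cdot> (k \<otimes> Id C Y)\<close>; injectivity of
    \<phi> then makes it two-sided.\<close>
  have \<phi>_comp: "\<phi> Z N (ev \<cdot> (k \<otimes> Id C Y)) = k" if "k \<in> hom C Z (Go N)" for Z k
  proof -
    have Z: "Z \<in> Obj C" using that hom_obj by blast
    have comp: "ev \<cdot> (k \<otimes> Id C Y) \<in> hom C (Z \<odot> Y) N"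
      using Comp_hom tensor_hom that Id_hom Y ev by blast
    show ?thesis
      using nat[OF H Z N N that ev Id_hom[OF N]] Id_Comp[OF comp] Id_Comp[OF that]
      by (simp add: \<phi>_ev G.functor_Id N)
  qed
  show thesis
  proof
    show "\<exists>!k. k \<in> hom C Z (Go N) \<and> ev \<cdot> (k \<otimes> Id C Y) = h"
      if Z: "Z \<in> Obj C" and h: "h \<in> hom C (Z \<odot> Y) N" for Z h
    proof (intro ex1I conjI)
      show k: "\<phi> Z N h \<in> hom C Z (Go N)"
        using bij[OF Z N] h by (rule bij_betw_apply)
      have comp: "ev \<cdot> (\<phi> Z N h \<otimes> Id C Y) \<in> hom C (Z \<odot> Y) N"
        using Comp_hom tensor_hom k Id_hom Y ev by blast
      show "ev \<cdot> (\<phi> Z N h \<otimes> Id C Y) = h"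
        using \<phi>_comp[OF k] comp h bij_betw_imp_inj_on[OF bij[OF Z N]] by (meson inj_onD)
    qed (metis \<phi>_comp)
  qed (fact H ev)+
qed

end


section \<open>Linear maps with parameters\<close>

context algebra_in
begin

section \<open>Right modules and module maps as an ordinary category\<close>

definition modules :: "('o \<times> 'a) set" where
  "modules = {(M, \<rho>). right_module C A m u M \<rho>}"

lemma moduleD:
  assumes "M \<in> modules"
  shows "fst M \<in> Obj C" "snd M \<in> Arr C" "Dom C (snd M) = fst M \<odot> A" "Cod C (snd M) = fst M"
  using assms by (auto simp: modules_def right_module_def hom_def)

lemma Id_in_module_hom:
  assumes "M \<in> modules"
  shows "Id C (fst M) \<in> module_hom C A M M"
  using moduleD[OF assms] by (simp add: module_hom_def Id_hom A_obj arr_simps)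

lemma comp_in_module_hom:
  assumes M: "L \<in> modules" "M \<in> modules" "N \<in> modules"
    and f: "f \<in> module_hom C A L M" and g: "g \<in> module_hom C A M N"
  shows "g \<cdot> f \<in> module_hom C A L N"
proof -
  have f_hom: "f \<in> hom C (fst L) (fst M)" and f_eq: "snd M \<cdot> (f \<otimes> Id C A) = f \<cdot> snd L"
    and g_hom: "g \<in> hom C (fst M) (fst N)" and g_eq: "snd N \<cdot> (g \<otimes> Id C A) = g \<cdot> snd M"
    using f g by (auto simp: module_hom_def)
  note [simp] = arr_simps A_obj homD[OF f_hom] homD[OF g_hom]
    moduleD[OF M(1)] moduleD[OF M(2)] moduleD[OF M(3)]
  have "snd N \<cdot> ((g \<cdot> f) \<otimes> Id C A) = snd N \<cdot> ((g \<otimes> Id C A) \<cdot> (f \<otimes> Id C A))"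
    by (subst interchange_arr) simp_all
  also have "\<dots> = (snd N \<cdot> (g \<otimes> Id C A)) \<cdot> (f \<otimes> Id C A)" by (simp add: comp_assoc_arr)
  also have "\<dots> = g \<cdot> (snd M \<cdot> (f \<otimes> Id C A))" unfolding g_eq by (simp add: comp_assoc_arr)
  also have "\<dots> = (g \<cdot> f) \<cdot> snd L" unfolding f_eq by (simp add: comp_assoc_arr)
  finally show ?thesis by (simp add: module_hom_def hom_def)
qed

lemma hom_module_category:
  "hom (module_category C A m u) M N
    = (if M \<in> modules \<and> N \<in> modules then (\<lambda>f. (M, f, N)) ` module_hom C A M N else {})"
  by (auto simp: hom_def module_category_def modules_def)

lemma category_module_category: "category (module_category C A m u)"
proof
  show "Id (module_category C A m u) M \<in> hom (module_category C A m u) M M"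
    if "M \<in> Obj (module_category C A m u)" for M
    using that Id_in_module_hom[of M] unfolding hom_module_category by (auto simp: module_category_def modules_def)
  show "g \<cdot>\<^bsub>module_category C A m u\<^esub> f \<in> hom (module_category C A m u) L N"
    if "f \<in> hom (module_category C A m u) L M" "g \<in> hom (module_category C A m u) M N" for f L M g N
    using that comp_in_module_hom[of L M N] unfolding hom_module_category
    by (auto simp: module_category_def split: if_splits)
next
  fix f M N assume "f \<in> hom (module_category C A m u) M N"
  then obtain f' where "f = (M, f', N)" "f' \<in> hom C (fst M) (fst N)"
    unfolding hom_module_category by (auto simp: module_hom_def split: if_splits)
  then show "f \<cdot>\<^bsub>module_category C A m u\<^esub> Id (module_category C A m u) M = f"
    "Id (module_category C A m u) N \<cdot>\<^bsub>module_category C A m u\<^esub> f = f"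
    using Comp_Id Id_Comp by (simp_all add: module_category_def)
next
  fix f g h K L M N
  assume "f \<in> hom (module_category C A m u) K L" "g \<in> hom (module_category C A m u) L M"
    "h \<in> hom (module_category C A m u) M N"
  then obtain f' g' h' where "f = (K, f', L)" "f' \<in> hom C (fst K) (fst L)"
    "g = (L, g', M)" "g' \<in> hom C (fst L) (fst M)" "h = (M, h', N)" "h' \<in> hom C (fst M) (fst N)"
    unfolding hom_module_category by (auto simp: module_hom_def split: if_splits)
  then show "(h \<cdot>\<^bsub>module_category C A m u\<^esub> g) \<cdot>\<^bsub>module_category C A m u\<^esub> f
      = h \<cdot>\<^bsub>module_category C A m u\<^esub> (g \<cdot>\<^bsub>module_category C A m u\<^esub> f)"
    using Comp_assoc by (simp add: module_category_def)
qed (auto simp: module_category_def modules_def)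

text \<open>This is \<open>module_hom\<close> from the pair
  \<open>(Z \<odot> fst M, Id C Z \<otimes> snd M)\<close> to \<open>N\<close>, with
  \<open>Z\<close> kept as a separate argument because it is the variable of the functor to be
  represented.\<close>

definition linear_maps :: "'o \<Rightarrow> 'o \<times> 'a \<Rightarrow> 'o \<times> 'a \<Rightarrow> 'a set" where
  "linear_maps Z M N =
     {h \<in> hom C (Z \<odot> fst M) (fst N). snd N \<cdot> (h \<otimes> Id C A) = h \<cdot> (Id C Z \<otimes> snd M)}"

lemma linear_mapsD:
  assumes "h \<in> linear_maps Z M N"
  shows "h \<in> hom C (Z \<odot> fst M) (fst N)"
    "snd N \<cdot> (h \<otimes> Id C A) = h \<cdot> (Id C Z \<otimes> snd M)"
    "h \<in> Arr C" "Dom C h = Z \<odot> fst M" "Cod C h = fst N"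
  using assms by (auto simp: linear_maps_def hom_def)

text \<open>Strictness deletes the unit factor. This is the bridge from arrows
  \<open>\<one> \<rightarrow> H M N\<close> to module maps.\<close>

lemma linear_maps_unit:
  assumes "M \<in> modules"
  shows "linear_maps \<one> M N = module_hom C A M N"
  using moduleD[OF assms] by (auto simp: linear_maps_def module_hom_def arr_simps)

text \<open>Contravariance in the parameter: \<open>k\<close> acts on \<open>Z'\<close> and the
  algebra on \<open>M\<close>, so the two commute by interchange, both orders giving
  \<open>k \<otimes> snd M\<close>.\<close>

lemma linear_maps_precomp:
  assumes M: "M \<in> modules" and N: "N \<in> modules"
    and h: "h \<in> linear_maps Z M N" and k: "k \<in> hom C Z' Z"
  shows "h \<cdot> (k \<otimes> Id C (fst M)) \<in> linear_maps Z' M N"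
proof -
  note [simp] = arr_simps A_obj moduleD[OF M] moduleD[OF N] linear_mapsD[OF h] homD[OF k]
  have Z [simp]: "Z \<in> Obj C" "Z' \<in> Obj C" using hom_obj[OF k] by auto
  have "snd N \<cdot> ((h \<cdot> (k \<otimes> Id C (fst M))) \<otimes> Id C A)
      = snd N \<cdot> ((h \<otimes> Id C A) \<cdot> (k \<otimes> Id C (fst M \<odot> A)))"
    using interchange_arr[of "k \<otimes> Id C (fst M)" h "Id C A" "Id C A"] by simp
  also have "\<dots> = (h \<cdot> (Id C Z \<otimes> snd M)) \<cdot> (k \<otimes> Id C (fst M \<odot> A))"
    using comp_assoc_arr[of "k \<otimes> Id C (fst M \<odot> A)" "h \<otimes> Id C A" "snd N"] by simp
  also have "\<dots> = h \<cdot> (k \<otimes> snd M)"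
    by (simp add: comp_assoc_arr interchange_arr del: linear_mapsD(2)[OF h])
  also have "\<dots> = (h \<cdot> (k \<otimes> Id C (fst M))) \<cdot> (Id C Z' \<otimes> snd M)"
    by (simp add: comp_assoc_arr interchange_arr)
  finally show ?thesis
    by (simp add: linear_maps_def hom_def)
qed

text \<open>The action is moved first past \<open>g\<close>, then past \<open>h\<close> under
  \<open>Id C Z'\<close>. The parameter of the outer map stands first, as in the source of
  \<open>EComp\<close>.\<close>

lemma linear_maps_comp:
  assumes M: "M \<in> modules" and N: "N \<in> modules" and P: "P \<in> modules"
    and Z: "Z \<in> Obj C" "Z' \<in> Obj C"
    and h: "h \<in> linear_maps Z M N" and g: "g \<in> linear_maps Z' N P"
  shows "g \<cdot> (Id C Z' \<otimes> h) \<in> linear_maps (Z' \<odot> Z) M P"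
proof -
  note [simp] = arr_simps A_obj Z moduleD[OF M] moduleD[OF N] moduleD[OF P]
    linear_mapsD(3-)[OF h] linear_mapsD(3-)[OF g]
  have "snd P \<cdot> ((g \<cdot> (Id C Z' \<otimes> h)) \<otimes> Id C A)
      = snd P \<cdot> ((g \<otimes> Id C A) \<cdot> (Id C Z' \<otimes> (h \<otimes> Id C A)))"
    using interchange_arr[of "Id C Z' \<otimes> h" g "Id C A" "Id C A"] by simp
  also have "\<dots> = (snd P \<cdot> (g \<otimes> Id C A)) \<cdot> (Id C Z' \<otimes> (h \<otimes> Id C A))"
    by (simp add: comp_assoc_arr)
  also have "\<dots> = g \<cdot> (Id C Z' \<otimes> (snd N \<cdot> (h \<otimes> Id C A)))"
    by (simp add: linear_mapsD(2)[OF g] comp_assoc_arr interchange_arr)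
  also have "\<dots> = g \<cdot> (Id C Z' \<otimes> (h \<cdot> (Id C Z \<otimes> snd M)))"
    by (simp add: linear_mapsD(2)[OF h])
  also have "\<dots> = g \<cdot> ((Id C Z' \<otimes> h) \<cdot> (Id C (Z' \<odot> Z) \<otimes> snd M))"
    using interchange_arr[of "Id C Z'" "Id C Z'" "Id C Z \<otimes> snd M" h]
      tensor_arr_assoc[of "Id C Z'" "Id C Z" "snd M"] by simp
  also have "\<dots> = (g \<cdot> (Id C Z' \<otimes> h)) \<cdot> (Id C (Z' \<odot> Z) \<otimes> snd M)"
    by (simp add: comp_assoc_arr)
  finally show ?thesis
    by (simp add: linear_maps_def hom_def)
qed

text \<open>Representability by a universal element: the bijection is evaluation along
  \<open>ev\<close>, so naturality in \<open>Z\<close> is built in.\<close>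

definition represents_linear_maps :: "'o \<Rightarrow> 'a \<Rightarrow> 'o \<times> 'a \<Rightarrow> 'o \<times> 'a \<Rightarrow> bool" where
  "represents_linear_maps H ev M N \<longleftrightarrow>
     H \<in> Obj C \<and> ev \<in> linear_maps H M N \<and>
     (\<forall>Z\<in>Obj C. \<forall>h\<in>linear_maps Z M N. \<exists>!k. k \<in> hom C Z H \<and> ev \<cdot> (k \<otimes> Id C (fst M)) = h)"

text \<open>Closedness supplies \<open>H\<close> and \<open>H'\<close>, and the equalizer cuts out
  the linear maps; the later construction sees only the universal property.\<close>

lemma linear_maps_representable:
  assumes closed: "right_closed_monoidal_category C" and eq: "has_equalizers C"
    and M: "M \<in> modules" and N: "N \<in> modules"
  shows "\<exists>H ev. represents_linear_maps H ev M N"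
proof -
  interpret right_closed_monoidal_category C by (fact closed)
  note [simp] = arr_simps A_obj moduleD[OF M] moduleD[OF N]
  obtain H ev where H [simp]: "H \<in> Obj C" and ev: "ev \<in> hom C (H \<odot> fst M) (fst N)"
    and ev_univ: "\<And>Z h. \<lbrakk>Z \<in> Obj C; h \<in> hom C (Z \<odot> fst M) (fst N)\<rbrakk>
      \<Longrightarrow> \<exists>!k. k \<in> hom C Z H \<and> ev \<cdot> (k \<otimes> Id C (fst M)) = h"
    using internal_hom_exists[of "fst M" "fst N"] by auto
  obtain H' ev' where H' [simp]: "H' \<in> Obj C" and ev': "ev' \<in> hom C (H' \<odot> (fst M \<odot> A)) (fst N)"
    and ev'_univ: "\<And>Z h. \<lbrakk>Z \<in> Obj C; h \<in> hom C (Z \<odot> (fst M \<odot> A)) (fst N)\<rbrakk>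
      \<Longrightarrow> \<exists>!k. k \<in> hom C Z H' \<and> ev' \<cdot> (k \<otimes> Id C (fst M \<odot> A)) = h"
    using internal_hom_exists[of "fst M \<odot> A" "fst N"] by auto
  note [simp] = homD[OF ev] homD[OF ev']
  \<comment> \<open>\<open>f\<close> names the map that evaluates and then acts, \<open>g\<close>
    the map that acts on \<open>M\<close> and then evaluates.\<close>
  obtain f where f: "f \<in> hom C H H'"
    and ev'_f: "ev' \<cdot> (f \<otimes> Id C (fst M \<odot> A)) = snd N \<cdot> (ev \<otimes> Id C A)"
    using ev'_univ[of H "snd N \<cdot> (ev \<otimes> Id C A)"] by (auto simp: hom_def)
  obtain g where g: "g \<in> hom C H H'"
    and ev'_g: "ev' \<cdot> (g \<otimes> Id C (fst M \<odot> A)) = ev \<cdot> (Id C H \<otimes> snd M)"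
    using ev'_univ[of H "ev \<cdot> (Id C H \<otimes> snd M)"] by (auto simp: hom_def)
  note [simp] = homD[OF f] homD[OF g]
  \<comment> \<open>Evaluating \<open>f \<cdot> k\<close> and \<open>g \<cdot> k\<close> through
    \<open>ev'\<close> yields the two sides of the linearity condition for the map named by
    \<open>k\<close>; uniqueness for \<open>ev'\<close> cancels the evaluation.\<close>
  have linear_iff: "ev \<cdot> (k \<otimes> Id C (fst M)) \<in> linear_maps Z M N \<longleftrightarrow> f \<cdot> k = g \<cdot> k"
    if k: "k \<in> hom C Z H" for k Z
  proof -
    have Z: "Z \<in> Obj C" using hom_obj[OF k] by simp
    note [simp] = Z homD[OF k]
    have "ev' \<cdot> ((f \<cdot> k) \<otimes> Id C (fst M \<odot> A))
        = (ev' \<cdot> (f \<otimes> Id C (fst M \<odot> A))) \<cdot> (k \<otimes> Id C (fst M \<odot> A))"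
      by (simp add: comp_assoc_arr interchange_arr)
    also have "\<dots> = snd N \<cdot> ((ev \<otimes> Id C A) \<cdot> ((k \<otimes> Id C (fst M)) \<otimes> Id C A))"
      unfolding ev'_f by (simp add: comp_assoc_arr)
    also have "\<dots> = snd N \<cdot> ((ev \<cdot> (k \<otimes> Id C (fst M))) \<otimes> Id C A)"
      by (subst interchange_arr) simp_all
    finally have left: "ev' \<cdot> ((f \<cdot> k) \<otimes> Id C (fst M \<odot> A))
        = snd N \<cdot> ((ev \<cdot> (k \<otimes> Id C (fst M))) \<otimes> Id C A)" .
    have "ev' \<cdot> ((g \<cdot> k) \<otimes> Id C (fst M \<odot> A))
        = (ev' \<cdot> (g \<otimes> Id C (fst M \<odot> A))) \<cdot> (k \<otimes> Id C (fst M \<odot> A))"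
      by (simp add: comp_assoc_arr interchange_arr)
    also have "\<dots> = (ev \<cdot> (k \<otimes> Id C (fst M))) \<cdot> (Id C Z \<otimes> snd M)"
      unfolding ev'_g by (simp add: comp_assoc_arr interchange_arr)
    finally have right: "ev' \<cdot> ((g \<cdot> k) \<otimes> Id C (fst M \<odot> A))
        = (ev \<cdot> (k \<otimes> Id C (fst M))) \<cdot> (Id C Z \<otimes> snd M)" .
    have "ev \<cdot> (k \<otimes> Id C (fst M)) \<in> linear_maps Z M N \<longleftrightarrow>
        ev' \<cdot> ((f \<cdot> k) \<otimes> Id C (fst M \<odot> A)) = ev' \<cdot> ((g \<cdot> k) \<otimes> Id C (fst M \<odot> A))"
      unfolding left right by (simp add: linear_maps_def hom_def)
    also have "\<dots> \<longleftrightarrow> f \<cdot> k = g \<cdot> k"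
    proof
      have "ev' \<cdot> ((g \<cdot> k) \<otimes> Id C (fst M \<odot> A)) \<in> hom C (Z \<odot> (fst M \<odot> A)) (fst N)"
        by (simp add: hom_def)
      then show "f \<cdot> k = g \<cdot> k"
        if "ev' \<cdot> ((f \<cdot> k) \<otimes> Id C (fst M \<odot> A)) = ev' \<cdot> ((g \<cdot> k) \<otimes> Id C (fst M \<odot> A))"
        using ev'_univ[OF Z] Comp_hom[OF k f] Comp_hom[OF k g] that by blast
    qed (rule arg_cong)
    finally show ?thesis .
  qed
  obtain E e where E: "is_equalizer C f g H H' E e"
    using eq f g H H' unfolding has_equalizers_def by blast
  have e: "e \<in> hom C E H" and fe: "f \<cdot> e = g \<cdot> e" and E_obj [simp]: "E \<in> Obj C"
    and e_univ: "\<And>Z h. \<lbrakk>Z \<in> Obj C; h \<in> hom C Z H; f \<cdot> h = g \<cdot> h\<rbrakk>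
      \<Longrightarrow> \<exists>!k. k \<in> hom C Z E \<and> e \<cdot> k = h"
    using E unfolding is_equalizer_def by auto
  note [simp] = homD[OF e]
  have comp: "(ev \<cdot> (e \<otimes> Id C (fst M))) \<cdot> (k \<otimes> Id C (fst M)) = ev \<cdot> ((e \<cdot> k) \<otimes> Id C (fst M))"
    if "k \<in> hom C Z E" for k Z
    using homD[OF that] by (simp add: comp_assoc_arr interchange_arr)
  have "represents_linear_maps E (ev \<cdot> (e \<otimes> Id C (fst M))) M N"
    unfolding represents_linear_maps_def
  proof (intro conjI ballI)
    show "ev \<cdot> (e \<otimes> Id C (fst M)) \<in> linear_maps E M N"
      using linear_iff[OF e] fe by simp
    fix Z h assume Z: "Z \<in> Obj C" and h: "h \<in> linear_maps Z M N"
    obtain k where k: "k \<in> hom C Z H" "ev \<cdot> (k \<otimes> Id C (fst M)) = h"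
      and k_unique: "\<And>k'. \<lbrakk>k' \<in> hom C Z H; ev \<cdot> (k' \<otimes> Id C (fst M)) = h\<rbrakk> \<Longrightarrow> k' = k"
      using ev_univ[OF Z linear_mapsD(1)[OF h]] by blast
    have "\<exists>!l. l \<in> hom C Z E \<and> e \<cdot> l = k"
      using e_univ[OF Z k(1)] linear_iff[OF k(1)] k(2) h by blast
    \<comment> \<open>Factorizations of \<open>h\<close> through the restricted evaluation are those
      of its name \<open>k\<close> through \<open>e\<close>, so existence and uniqueness come from
      the equalizer.\<close>
    moreover have "(ev \<cdot> (e \<otimes> Id C (fst M))) \<cdot> (l \<otimes> Id C (fst M)) = h \<longleftrightarrow> e \<cdot> l = k"
      if "l \<in> hom C Z E" for l
      unfolding comp[OF that] using k(2) k_unique[OF Comp_hom[OF that e]] by blast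
    \<comment> \<open>The equivalence holds only for \<open>l\<close> of the right type;
      \<open>conj_cong\<close> makes that conjunct available while the other one is
      rewritten.\<close>
    ultimately show "\<exists>!l. l \<in> hom C Z E \<and> (ev \<cdot> (e \<otimes> Id C (fst M))) \<cdot> (l \<otimes> Id C (fst M)) = h"
      by (simp cong: conj_cong)
  qed (rule E_obj)
  then show ?thesis by blast
qed

end


section \<open>The enriched category of modules\<close>

text \<open>One representing pair is fixed for each pair of modules, and only its universal property
  is assumed.\<close>

locale internal_module_homs = algebra_in C A m u
  for C :: "('o, 'a, 'z) moncat_scheme" (structure) and A :: 'o and m u :: 'a +
  fixes H :: "'o \<times> 'a \<Rightarrow> 'o \<times> 'a \<Rightarrow> 'o" and ev :: "'o \<times> 'a \<Rightarrow> 'o \<times> 'a \<Rightarrow> 'a"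
  assumes represents: "\<lbrakk>M \<in> modules; N \<in> modules\<rbrakk> \<Longrightarrow> represents_linear_maps (H M N) (ev M N) M N"
begin

section \<open>Currying of linear maps\<close>

definition uncurry :: "'o \<times> 'a \<Rightarrow> 'o \<times> 'a \<Rightarrow> 'a \<Rightarrow> 'a" where
  "uncurry M N k = ev M N \<cdot> (k \<otimes> Id C (fst M))"

text \<open>The description is known to denote for linear \<open>h\<close>, by
  \<open>uncurry_unique\<close>.\<close>

definition curry :: "'o \<times> 'a \<Rightarrow> 'o \<times> 'a \<Rightarrow> 'o \<Rightarrow> 'a \<Rightarrow> 'a" where
  "curry M N Z h = (THE k. k \<in> hom C Z (H M N) \<and> uncurry M N k = h)"

lemma H_obj: "\<lbrakk>M \<in> modules; N \<in> modules\<rbrakk> \<Longrightarrow> H M N \<in> Obj C"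
  and ev_linear: "\<lbrakk>M \<in> modules; N \<in> modules\<rbrakk> \<Longrightarrow> ev M N \<in> linear_maps (H M N) M N"
  using represents unfolding represents_linear_maps_def by blast+

lemma uncurry_unique:
  assumes "M \<in> modules" "N \<in> modules" "h \<in> linear_maps Z M N" "Z \<in> Obj C"
  shows "\<exists>!k. k \<in> hom C Z (H M N) \<and> uncurry M N k = h"
  using represents[of M N] assms unfolding represents_linear_maps_def uncurry_def by blast

lemma curry_hom: "\<lbrakk>M \<in> modules; N \<in> modules; h \<in> linear_maps Z M N; Z \<in> Obj C\<rbrakk>
    \<Longrightarrow> curry M N Z h \<in> hom C Z (H M N)"
  and uncurry_curry: "\<lbrakk>M \<in> modules; N \<in> modules; h \<in> linear_maps Z M N; Z \<in> Obj C\<rbrakk>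
    \<Longrightarrow> uncurry M N (curry M N Z h) = h"
  using theI'[OF uncurry_unique, of M N h Z] unfolding curry_def by blast+

lemma uncurry_linear:
  assumes "M \<in> modules" "N \<in> modules" "k \<in> hom C Z (H M N)"
  shows "uncurry M N k \<in> linear_maps Z M N"
  unfolding uncurry_def using assms ev_linear linear_maps_precomp by blast

text \<open>Reduces equations between arrows into a Hom-object to equations between linear
  maps.\<close>

lemma uncurry_inject:
  assumes "M \<in> modules" "N \<in> modules" "k \<in> hom C Z (H M N)" "k' \<in> hom C Z (H M N)"
    and "uncurry M N k = uncurry M N k'"
  shows "k = k'"
  using uncurry_unique[OF assms(1,2) uncurry_linear[OF assms(1-3)]] hom_obj[OF assms(3)] assms(3-)
  by auto

lemma uncurry_bij:
  assumes "M \<in> modules" "N \<in> modules" "Z \<in> Obj C"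
  shows "bij_betw (uncurry M N) (hom C Z (H M N)) (linear_maps Z M N)"
proof (rule bij_betw_imageI)
  show "inj_on (uncurry M N) (hom C Z (H M N))"
    using uncurry_inject[OF assms(1,2)] by (auto intro: inj_onI)
  show "uncurry M N ` hom C Z (H M N) = linear_maps Z M N"
    using uncurry_linear[OF assms(1,2)] uncurry_unique[OF assms(1,2) _ assms(3)] by blast
qed

lemma uncurry_Id:
  assumes M: "M \<in> modules" and N: "N \<in> modules"
  shows "uncurry M N (Id C (H M N)) = ev M N"
  using linear_mapsD(3-)[OF ev_linear[OF M N]] H_obj[OF M N] moduleD[OF M] moduleD[OF N]
  by (simp add: uncurry_def arr_simps)

text \<open>Naturality of \<open>uncurry\<close> in the parameter.\<close>

lemma uncurry_comp:
  assumes M: "M \<in> modules" and N: "N \<in> modules"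
    and k: "k \<in> hom C Z (H M N)" and l: "l \<in> hom C Z' Z"
  shows "uncurry M N (k \<cdot> l) = uncurry M N k \<cdot> (l \<otimes> Id C (fst M))"
  using linear_mapsD(3-)[OF ev_linear[OF M N]] H_obj[OF M N] moduleD[OF M] moduleD[OF N]
    homD[OF k] homD[OF l]
  by (simp add: uncurry_def arr_simps comp_assoc_arr interchange_arr)

section \<open>Identities and composition\<close>

definition id_elem :: "'o \<times> 'a \<Rightarrow> 'a" where
  "id_elem M = curry M M \<one> (Id C (fst M))"

text \<open>Curries the double evaluation \<open>H N P \<odot> H M N \<odot> fst M \<rightarrow> H N
  P \<odot> fst N \<rightarrow> fst P\<close>.\<close>

definition comp_arrow :: "'o \<times> 'a \<Rightarrow> 'o \<times> 'a \<Rightarrow> 'o \<times> 'a \<Rightarrow> 'a" where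
  "comp_arrow M N P = curry M P (H N P \<odot> H M N) (ev N P \<cdot> (Id C (H N P) \<otimes> ev M N))"

lemma id_elem_hom: "M \<in> modules \<Longrightarrow> id_elem M \<in> hom C \<one> (H M M)"
  and uncurry_id_elem: "M \<in> modules \<Longrightarrow> uncurry M M (id_elem M) = Id C (fst M)"
  using Id_in_module_hom linear_maps_unit curry_hom uncurry_curry unit_obj
  unfolding id_elem_def by blast+

context
  fixes M N P
  assumes MNP: "M \<in> modules" "N \<in> modules" "P \<in> modules"
begin

lemma comp_arrow_hom: "comp_arrow M N P \<in> hom C (H N P \<odot> H M N) (H M P)"
  and uncurry_comp_arrow: "uncurry M P (comp_arrow M N P) = ev N P \<cdot> (Id C (H N P) \<otimes> ev M N)"
  using curry_hom uncurry_curry linear_maps_comp ev_linear H_obj tensor_obj MNP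
  unfolding comp_arrow_def by meson+

text \<open>The unit laws, associativity and functoriality are all instances of this equation, since
  arrows into \<open>H M P\<close> are determined by their images under \<open>uncurry\<close>.\<close>

lemma uncurry_comp_arrow_tensor:
  assumes g: "g \<in> hom C Z' (H N P)" and f: "f \<in> hom C Z (H M N)"
  shows "uncurry M P (comp_arrow M N P \<cdot> (g \<otimes> f)) = uncurry N P g \<cdot> (Id C Z' \<otimes> uncurry M N f)"
proof -
  note [simp] = arr_simps homD[OF g] homD[OF f] hom_obj[OF g] hom_obj[OF f]
    moduleD[OF MNP(1)] moduleD[OF MNP(2)] moduleD[OF MNP(3)]
    linear_mapsD(3-)[OF ev_linear[OF MNP(1,2)]] linear_mapsD(3-)[OF ev_linear[OF MNP(2,3)]]
  have "uncurry M P (comp_arrow M N P \<cdot> (g \<otimes> f))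
      = (ev N P \<cdot> (Id C (H N P) \<otimes> ev M N)) \<cdot> (g \<otimes> (f \<otimes> Id C (fst M)))"
    using uncurry_comp[OF MNP(1,3) comp_arrow_hom tensor_hom[OF g f]] by (simp add: uncurry_comp_arrow)
  \<comment> \<open>Interchange moves \<open>f\<close> into the inner evaluation; the next step
    splits \<open>g\<close> off into the outer one.\<close>
  also have "\<dots> = ev N P \<cdot> (g \<otimes> uncurry M N f)"
    by (simp add: uncurry_def comp_assoc_arr interchange_arr)
  also have "\<dots> = uncurry N P g \<cdot> (Id C Z' \<otimes> uncurry M N f)"
    by (simp add: uncurry_def comp_assoc_arr interchange_arr)
  finally show ?thesis .
qed

end

section \<open>The enriched category and its laws\<close>

definition module_encat :: "('o \<times> 'a, 'o, 'a) encat" where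
  "module_encat = \<lparr>EObj = modules, EHom = H, EId = id_elem, EComp = comp_arrow\<rparr>"

text \<open>In both laws, each side uncurries to \<open>ev M N\<close>.\<close>

lemma comp_arrow_id_elem:
  assumes M: "M \<in> modules" and N: "N \<in> modules"
  shows "comp_arrow M M N \<cdot> (Id C (H M N) \<otimes> id_elem M) = Id C (H M N)" (is ?right)
    and "comp_arrow M N N \<cdot> (id_elem N \<otimes> Id C (H M N)) = Id C (H M N)" (is ?left)
proof -
  note [simp] = arr_simps H_obj[OF M N] moduleD(1)[OF M] moduleD(1)[OF N]
    linear_mapsD(3-)[OF ev_linear[OF M N]] uncurry_id_elem uncurry_Id M N
  have Id: "Id C (H M N) \<in> hom C (H M N) (H M N)" by (simp add: Id_hom)
  show ?right
  proof (rule uncurry_inject[OF M N _ Id])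
    show "comp_arrow M M N \<cdot> (Id C (H M N) \<otimes> id_elem M) \<in> hom C (H M N) (H M N)"
      using Comp_hom[OF tensor_hom[OF Id id_elem_hom[OF M]] comp_arrow_hom[OF M M N]] by simp
    show "uncurry M N (comp_arrow M M N \<cdot> (Id C (H M N) \<otimes> id_elem M)) = uncurry M N (Id C (H M N))"
      using uncurry_comp_arrow_tensor[OF M M N Id id_elem_hom[OF M]] by simp
  qed
  show ?left
  proof (rule uncurry_inject[OF M N _ Id])
    show "comp_arrow M N N \<cdot> (id_elem N \<otimes> Id C (H M N)) \<in> hom C (H M N) (H M N)"
      using Comp_hom[OF tensor_hom[OF id_elem_hom[OF N] Id] comp_arrow_hom[OF M N N]] by simp
    show "uncurry M N (comp_arrow M N N \<cdot> (id_elem N \<otimes> Id C (H M N))) = uncurry M N (Id C (H M N))"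
      using uncurry_comp_arrow_tensor[OF M N N id_elem_hom[OF N] Id] by simp
  qed
qed

text \<open>Both sides uncurry to the triple evaluation, which applies \<open>ev L M\<close>, then
  \<open>ev M N\<close>, then \<open>ev N P\<close>.\<close>

lemma comp_arrow_assoc:
  assumes M: "L \<in> modules" "M \<in> modules" "N \<in> modules" "P \<in> modules"
  shows "comp_arrow L M P \<cdot> (comp_arrow M N P \<otimes> Id C (H L M))
    = comp_arrow L N P \<cdot> (Id C (H N P) \<otimes> comp_arrow L M N)"
proof (rule uncurry_inject[OF M(1,4)])
  note [simp] = M arr_simps H_obj moduleD(1) uncurry_Id uncurry_comp_arrow
    linear_mapsD(3-)[OF ev_linear[OF M(1,2)]] linear_mapsD(3-)[OF ev_linear[OF M(2,3)]]
    linear_mapsD(3-)[OF ev_linear[OF M(3,4)]]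
  have Id: "Id C (H L M) \<in> hom C (H L M) (H L M)" "Id C (H N P) \<in> hom C (H N P) (H N P)"
    by (simp_all add: Id_hom)
  note c = comp_arrow_hom[OF M(2-4)] comp_arrow_hom[OF M(1-3)]
  show "comp_arrow L M P \<cdot> (comp_arrow M N P \<otimes> Id C (H L M))
      \<in> hom C (H N P \<odot> (H M N \<odot> H L M)) (H L P)"
    using Comp_hom[OF tensor_hom[OF c(1) Id(1)] comp_arrow_hom[OF M(1,2,4)]] by simp
  show "comp_arrow L N P \<cdot> (Id C (H N P) \<otimes> comp_arrow L M N)
      \<in> hom C (H N P \<odot> (H M N \<odot> H L M)) (H L P)"
    using Comp_hom[OF tensor_hom[OF Id(2) c(2)] comp_arrow_hom[OF M(1,3,4)]] by simp
  have "uncurry L P (comp_arrow L M P \<cdot> (comp_arrow M N P \<otimes> Id C (H L M)))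
      = (ev N P \<cdot> (Id C (H N P) \<otimes> ev M N)) \<cdot> (Id C (H N P \<odot> H M N) \<otimes> ev L M)"
    using uncurry_comp_arrow_tensor[OF M(1,2,4) c(1) Id(1)] by simp
  also have "\<dots> = ev N P \<cdot> ((Id C (H N P) \<otimes> ev M N) \<cdot> (Id C (H N P) \<otimes> (Id C (H M N) \<otimes> ev L M)))"
    using tensor_arr_assoc[of "Id C (H N P)" "Id C (H M N)" "ev L M"] by (simp add: comp_assoc_arr)
  also have "\<dots> = ev N P \<cdot> (Id C (H N P) \<otimes> (ev M N \<cdot> (Id C (H M N) \<otimes> ev L M)))"
    by (simp add: interchange_arr)
  also have "\<dots> = uncurry L P (comp_arrow L N P \<cdot> (Id C (H N P) \<otimes> comp_arrow L M N))"
    using uncurry_comp_arrow_tensor[OF M(1,3,4) Id(2) c(2)] by simp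
  finally show "uncurry L P (comp_arrow L M P \<cdot> (comp_arrow M N P \<otimes> Id C (H L M)))
      = uncurry L P (comp_arrow L N P \<cdot> (Id C (H N P) \<otimes> comp_arrow L M N))" .
qed

lemma module_encat_enriched: "enriched_category C module_encat"
  by unfold_locales
    (simp_all only: module_encat_def encat.simps H_obj id_elem_hom comp_arrow_hom comp_arrow_assoc
      comp_arrow_id_elem)

text \<open>At parameter \<open>\<one>\<close>, \<open>uncurry\<close> is a bijection onto module
  maps, and the equation for \<open>comp_arrow\<close> on tensors becomes functoriality.\<close>

lemma underlying_category_module_encat:
  "cat_isomorphism (underlying_category C module_encat) (module_category C A m u)
    (\<lambda>X. X) (\<lambda>(M, f, N). (M, uncurry M N f, N))"
  (is "cat_isomorphism ?U ?D _ ?F")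
proof -
  interpret E: enriched_category C module_encat by (rule module_encat_enriched)
  have fields: "EObj module_encat = modules" "EHom module_encat = H" "EId module_encat = id_elem"
    "EComp module_encat = comp_arrow"
    by (simp_all add: module_encat_def)
  have objs: "Obj ?U = modules" "Obj ?D = modules"
    by (simp_all add: underlying_category_def module_category_def modules_def fields)
  have U_hom: "a \<in> hom ?U M N \<longleftrightarrow> (\<exists>f\<in>hom C \<one> (H M N). a = (M, f, N)) \<and> M \<in> modules \<and> N \<in> modules"
    for a M N
    unfolding E.hom_underlying_category fields by auto
  have bij: "bij_betw (uncurry M N) (hom C \<one> (H M N)) (module_hom C A M N)"
    if "M \<in> modules" "N \<in> modules" for M N
    using uncurry_bij[OF that unit_obj] linear_maps_unit[OF that(1)] by simp
  have "cat_functor ?U ?D (\<lambda>X. X) ?F"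
  proof (intro cat_functor.intro cat_functor_axioms.intro)
    show "?F f \<in> hom ?D X Y" if "f \<in> hom ?U X Y" for f X Y
      using that bij_betw_apply[OF bij[of X Y]] by (auto simp: U_hom hom_module_category)
    show "?F (Id ?U X) = Id ?D X" if "X \<in> Obj ?U" for X
      using that uncurry_id_elem[of X] unfolding objs
      by (simp add: underlying_category_def module_category_def fields)
    show "?F (g \<cdot>\<^bsub>?U\<^esub> f) = ?F g \<cdot>\<^bsub>?D\<^esub> ?F f"
      if "f \<in> hom ?U X Y" "g \<in> hom ?U Y Z" for f X Y g Z
    proof -
      obtain f' g' where f': "f' \<in> hom C \<one> (H X Y)" "f = (X, f', Y)"
        and g': "g' \<in> hom C \<one> (H Y Z)" "g = (Y, g', Z)"
        and M: "X \<in> modules" "Y \<in> modules" "Z \<in> modules"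
        using \<open>f \<in> hom ?U X Y\<close> \<open>g \<in> hom ?U Y Z\<close> unfolding U_hom by blast
      \<comment> \<open>With unit parameters the whiskering disappears, leaving the ordinary
        composite of module maps.\<close>
      have "Id C \<one> \<otimes> uncurry X Y f' = uncurry X Y f'"
        using linear_mapsD(3)[OF uncurry_linear[OF M(1,2) f'(1)]] by (rule unit_tensor_arr)
      then show ?thesis
        using uncurry_comp_arrow_tensor[OF M g'(1) f'(1)]
        by (simp add: f'(2) g'(2) underlying_category_def module_category_def fields)
    qed
  qed (simp_all only: objs E.category_underlying_category category_module_category)
  moreover have "bij_betw ?F (Arr ?U) (Arr ?D)"
  proof (rule bij_betw_imageI)
    have arrs: "Arr ?U = (\<Union>M\<in>modules. \<Union>N\<in>modules. (\<lambda>f. (M, f, N)) ` hom C \<one> (H M N))"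
      "Arr ?D = (\<Union>M\<in>modules. \<Union>N\<in>modules. (\<lambda>f. (M, f, N)) ` module_hom C A M N)"
      by (auto simp: underlying_category_def module_category_def modules_def fields)
    show "inj_on ?F (Arr ?U)"
    proof (rule inj_onI)
      fix a b assume "a \<in> Arr ?U" "b \<in> Arr ?U" and eq: "?F a = ?F b"
      then obtain M f N M' f' N' where a: "a = (M, f, N)" "M \<in> modules" "N \<in> modules" "f \<in> hom C \<one> (H M N)"
        and b: "b = (M', f', N')" "f' \<in> hom C \<one> (H M' N')"
        unfolding arrs by blast
      \<comment> \<open>The triples retain source and target, so injectivity is needed only within a
        single Hom-set.\<close>
      have MN: "M' = M" "N' = N" and "uncurry M N f = uncurry M N f'"
        using eq unfolding a(1) b(1) by auto
      then have "f = f'"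
        using uncurry_inject[OF a(2-4)] b(2) by blast
      then show "a = b" unfolding a(1) b(1) MN by simp
    qed
    have "?F ` Arr ?U
        = (\<Union>M\<in>modules. \<Union>N\<in>modules. (\<lambda>f. (M, f, N)) ` uncurry M N ` hom C \<one> (H M N))"
      unfolding arrs by (simp only: image_UN image_image prod.case)
    also have "\<dots> = Arr ?D"
      unfolding arrs by (intro SUP_cong refl) (simp only: bij_betw_imp_surj_on[OF bij])
    finally show "?F ` Arr ?U = Arr ?D" .
  qed
  moreover have "bij_betw (\<lambda>X. X) (Obj ?U) (Obj ?D)"
    unfolding objs by (simp add: bij_betw_def)
  ultimately show ?thesis
    unfolding cat_isomorphism_def by blast
qed

end

theorem theorem3p14:
  fixes C :: "('o, 'a) moncat" and A :: 'o and m u :: 'a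
  assumes "right_closed_monoidal_category C"
    and "algebra_in C A m u"
    and "has_equalizers C"
  shows "enriched_over (module_category C A m u) C"
proof -
  interpret algebra_in C A m u by fact
  \<comment> \<open>Choice turns the existence of representing pairs into functions \<open>H\<close>
    and \<open>ev\<close>.\<close>
  obtain H ev where "\<And>M N. \<lbrakk>M \<in> modules; N \<in> modules\<rbrakk> \<Longrightarrow> represents_linear_maps (H M N) (ev M N) M N"
    using linear_maps_representable[OF assms(1,3)] by metis
  then interpret internal_module_homs C A m u H ev by unfold_locales
  have "EObj module_encat = Obj (module_category C A m u)"
    by (simp add: module_encat_def module_category_def modules_def)
  then show ?thesis
    using module_encat_enriched underlying_category_module_encat unfolding enriched_over_def by blast
qed

end
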